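(* Let $\Omega$ be a set of nonzero $n$-tuples over $\{0,1\}$ such that either $s(\beta)$ is even for all $\beta\in\Omega$ or $s(\beta)$ is odd for all $\beta\in\Omega$. Let $k=\min_{\beta\in\Omega}s(\beta)$ and $\Omega^{*}=\{\beta\in\Omega: s(\beta)=k\}$. Then $H_{\Omega}(\tau_{k})=H_{\Omega^{*}}(\tau_{k})$, where $H_{\Omega}(t)$ and $H_{\Omega^{*}}(t)$ are the transition matrices of $NEPS(P_{3},\ldots,P_{3};\Omega)$ and $NEPS(P_{3},\ldots,P_{3};\Omega^{*})$ respectively.
   Context: $P_{3}$ is the path with vertices $1,2,3$ where $1$ and $3$ are adjacent to $2$. For a set $\Omega$ of nonzero $n$-tuples $\beta\in\{0,1\}^{n}$, $NEPS(P_{3},\ldots,P_{3};\Omega)$ ($n$ factors) has vertex set $\{1,2,3\}^{n}$, and $(x_{i})$, $(y_{i})$ are adjacent iff for some $\beta\in\Omega$, $x_{i}=y_{i}$ whenever $\beta_{i}=0$ and $x_{i}$ is adjacent to $y_{i}$ in $P_{3}$ whenever $\beta_{i}=1$. Both NEPS share the same vertex set, ordered lexicographically. The transition matrix of a graph with adjacency matrix $A$ is $\exp(-itA)$. $s(\beta)$ is the number of nonzero entries of $\beta$, and $\tau_{k}=\pi/(\sqrt{2})^{k}$. *)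

theory Defs
  imports Complex_Main "HOL-Library.List_Lexorder" "Jordan_Normal_Form.Matrix"
begin

definition P3_adj :: "nat \<Rightarrow> nat \<Rightarrow> bool" where
  "P3_adj x y \<longleftrightarrow> {x, y} = {1, 2} \<or> {x, y} = {2, 3}"

text \<open>Tuples are lists of length \<open>n\<close>; the list below enumerates \<open>{1,2,3}\<^sup>n\<close> in
  lexicographic order (see the two lemmas after it) and so fixes the indexing of all matrices.\<close>

definition P3_tuples :: "nat \<Rightarrow> nat list list" where
  "P3_tuples n = product_lists (replicate n [1, 2, 3])"

lemma set_P3_tuples: "set (P3_tuples n) = {xs. length xs = n \<and> set xs \<subseteq> {1, 2, 3}}"
proof (induction n)
  case 0
  show ?case by (auto simp: P3_tuples_def)
next
  case (Suc n)
  have "set (P3_tuples (Suc n)) = (\<Union>x\<in>{1,2,3}. Cons x ` set (P3_tuples n))"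
    by (simp add: P3_tuples_def)
  then show ?case
    unfolding Suc by (auto simp: length_Suc_conv)
qed

lemma sorted_P3_tuples: "sorted_wrt (<) (P3_tuples n)"
proof (induction n)
  case 0
  show ?case by (simp add: P3_tuples_def)
next
  case (Suc n)
  have "P3_tuples (Suc n) = map (Cons 1) (P3_tuples n) @ map (Cons 2) (P3_tuples n)
      @ map (Cons 3) (P3_tuples n)"
    by (simp add: P3_tuples_def)
  then show ?case
    using Suc by (auto simp: sorted_wrt_append sorted_wrt_map)
qed

text \<open>Adjacency in \<open>NEPS(P\<^sub>3, \<dots>, P\<^sub>3; \<Omega>)\<close> with \<open>n\<close> factors.\<close>

definition NEPS_P3_adj :: "nat \<Rightarrow> nat list set \<Rightarrow> nat list \<Rightarrow> nat list \<Rightarrow> bool" where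
  "NEPS_P3_adj n \<Omega> x y \<longleftrightarrow>
     (\<exists>\<beta>\<in>\<Omega>. \<forall>i<n. (\<beta> ! i = 0 \<longrightarrow> x ! i = y ! i) \<and> (\<beta> ! i = 1 \<longrightarrow> P3_adj (x ! i) (y ! i)))"

definition adjacency_mat :: "'v list \<Rightarrow> ('v \<Rightarrow> 'v \<Rightarrow> bool) \<Rightarrow> complex mat" where
  "adjacency_mat vs E =
     mat (length vs) (length vs) (\<lambda>(i, j). if E (vs ! i) (vs ! j) then 1 else 0)"

text \<open>The exponential of a square matrix, as the entrywise sum of its power series;
  \<open>summable_mat_exp\<close> shows that the series converges absolutely.\<close>

definition mat_exp :: "complex mat \<Rightarrow> complex mat" where
  "mat_exp A = mat (dim_row A) (dim_row A) (\<lambda>(i, j). \<Sum>k. (A ^\<^sub>m k) $$ (i, j) / fact k)"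

lemma norm_pow_mat_le:
  assumes A: "A \<in> carrier_mat n n"
    and c: "\<And>i j. i < n \<Longrightarrow> j < n \<Longrightarrow> norm (A $$ (i, j)) \<le> c"
    and ij: "i < n" "j < n"
  shows "norm ((A ^\<^sub>m k) $$ (i, j) :: complex) \<le> (real n * c) ^ k"
  using ij
proof (induction k arbitrary: i j)
  case 0
  then show ?case using A by auto
next
  case (Suc k)
  have c0: "0 \<le> c"
    using c[OF Suc.prems] norm_ge_zero order_trans by blast
  have "norm ((A ^\<^sub>m Suc k) $$ (i, j)) = norm (\<Sum>l\<in>{0..<n}. (A ^\<^sub>m k) $$ (i, l) * A $$ (l, j))"
    using A Suc.prems by (simp add: scalar_prod_def)
  also have "\<dots> \<le> (\<Sum>l\<in>{0..<n}. (real n * c) ^ k * c)"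
    by (rule sum_norm_le) (use Suc c c0 in \<open>auto simp: norm_mult intro!: mult_mono\<close>)
  finally show ?case by (simp add: algebra_simps)
qed

lemma summable_mat_exp:
  assumes A: "A \<in> carrier_mat n n" and ij: "i < n" "j < n"
  shows "summable (\<lambda>k. norm ((A ^\<^sub>m k) $$ (i, j) / fact k :: complex))"
proof -
  define c where "c = Max ((\<lambda>(i, j). norm (A $$ (i, j))) ` ({..<n} \<times> {..<n}))"
  have c: "norm (A $$ (i, j)) \<le> c" if "i < n" "j < n" for i j
    unfolding c_def by (rule Max_ge) (use that in auto)
  have "summable (\<lambda>k. (real n * c) ^ k / fact k)"
    using summable_exp[of "real n * c"] by (simp add: field_simps)
  then show ?thesis
  proof (rule summable_comparison_test')
    fix k :: nat
    show "norm (norm ((A ^\<^sub>m k) $$ (i, j) / fact k)) \<le> (real n * c) ^ k / fact k"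
      using norm_pow_mat_le[OF A c ij, of k] by (simp add: norm_divide divide_right_mono)
  qed
qed

definition transition_mat :: "complex mat \<Rightarrow> real \<Rightarrow> complex mat" where
  "transition_mat A t = mat_exp ((- \<i> * complex_of_real t) \<cdot>\<^sub>m A)"

definition H_NEPS_P3 :: "nat \<Rightarrow> nat list set \<Rightarrow> real \<Rightarrow> complex mat" where
  "H_NEPS_P3 n \<Omega> t = transition_mat (adjacency_mat (P3_tuples n) (NEPS_P3_adj n \<Omega>)) t"

definition num_nonzero :: "nat list \<Rightarrow> nat" where
  "num_nonzero \<beta> = length (filter (\<lambda>b. b \<noteq> 0) \<beta>)"

end

(* The adjacency matrix of P3 is diagonalised by a symmetric involution, with eigenvalues
   sqrt 2, 0, -sqrt 2.  Its n-th tensor power therefore diagonalises all the adjacency matrices of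
   NEPS(P3, ..., P3; Omega) at once, and each tuple beta contributes to every eigenvalue an
   integer multiple of (sqrt 2)^s(beta).  If s(beta) exceeds k by a positive even number, then
   tau_k times this contribution is an integer multiple of 2 pi, which is invisible to exp(-i _). *)

theory Submission
  imports Defs
begin

section \<open>Exponentials of diagonalisable matrices\<close>

lemma mat_diag_pow: "mat_diag n d ^\<^sub>m k = mat_diag n (\<lambda>i. d i ^ k :: 'a :: comm_semiring_1)"
proof (induction k)
  case 0
  show ?case by (simp add: mat_diag_def)
next
  case (Suc k)
  then show ?case by (simp add: mult.commute)
qed

lemma index_mult_mat_diag_mult:
  fixes P Q :: "'a :: comm_ring_1 mat"
  assumes "P \<in> carrier_mat n n" "Q \<in> carrier_mat n n" "i < n" "j < n"
  shows "(P * mat_diag n d * Q) $$ (i, j) = (\<Sum>l<n. P $$ (i, l) * d l * Q $$ (l, j))"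
  using assms by (simp add: mat_diag_mult_right[OF assms(1)] scalar_prod_def atLeast0LessThan)

text \<open>Each power of \<open>A\<close> is \<open>P\<close> times a diagonal power times
  \<open>Q\<close>, so an entry of the series is a finite linear combination of the scalar
  exponential series of the \<open>d l\<close>.\<close>

lemma mat_exp_diagonalizable:
  assumes "similar_mat_wit A (mat_diag n d) P Q"
  shows "mat_exp A = P * mat_diag n (\<lambda>i. exp (d i)) * Q"
proof -
  have "dim_row A = n"
    using carrier_matD(1)[OF similar_mat_witD(5)[OF refl assms]] by (simp add: mat_diag_def)
  then have A: "A \<in> carrier_mat n n" and P: "P \<in> carrier_mat n n" and Q: "Q \<in> carrier_mat n n"
    using similar_mat_witD[OF _ assms, of n] by auto
  have "(\<Sum>k. (A ^\<^sub>m k) $$ (i, j) / fact k) = (P * mat_diag n (\<lambda>i. exp (d i)) * Q) $$ (i, j)"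
    if ij: "i < n" "j < n" for i j
  proof -
    \<comment> \<open>The factorial is attached to \<open>d l ^ k\<close> so that each summand
      matches the series in \<open>exp_converges\<close>.\<close>
    have "(A ^\<^sub>m k) $$ (i, j) / fact k = (\<Sum>l<n. P $$ (i, l) * (d l ^ k /\<^sub>R fact k) * Q $$ (l, j))" for k
      unfolding similar_mat_wit_pow_id[OF assms] mat_diag_pow index_mult_mat_diag_mult[OF P Q ij]
      by (simp add: sum_divide_distrib scaleR_conv_of_real field_simps)
    moreover have "(\<lambda>k. \<Sum>l<n. P $$ (i, l) * (d l ^ k /\<^sub>R fact k) * Q $$ (l, j)) sums
        (\<Sum>l<n. P $$ (i, l) * exp (d l) * Q $$ (l, j))"
      by (intro sums_sum sums_mult sums_mult2 exp_converges)
    ultimately show ?thesis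
      by (simp add: index_mult_mat_diag_mult[OF P Q ij] sums_iff)
  qed
  then show ?thesis
    using A P Q by (intro eq_matI) (auto simp: mat_exp_def)
qed

section \<open>Tensor products over tuples\<close>

text \<open>Distributivity, one coordinate at a time. It reduces identities between tensor products
  to identities in a single factor.\<close>

lemma sum_P3_tuples_prod:
  fixes g :: "nat \<Rightarrow> nat \<Rightarrow> 'a :: comm_semiring_1"
  shows "(\<Sum>z\<leftarrow>P3_tuples n. \<Prod>i<n. g i (z ! i)) = (\<Prod>i<n. \<Sum>a\<in>{1, 2, 3}. g i a)"
proof (induction n arbitrary: g)
  case 0
  show ?case by (simp add: P3_tuples_def)
next
  case (Suc n)
  have tuples: "P3_tuples (Suc n) = map (Cons 1) (P3_tuples n) @ map (Cons 2) (P3_tuples n)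
      @ map (Cons 3) (P3_tuples n)"
    by (simp add: P3_tuples_def)
  \<comment> \<open>The induction hypothesis is applied to the shifted family
    \<open>\<lambda>i. g (Suc i)\<close>, because a new head moves all other coordinates up by
    one.\<close>
  have "(\<Sum>z\<leftarrow>map (Cons a) (P3_tuples n). \<Prod>i<Suc n. g i (z ! i)) =
      g 0 a * (\<Prod>i<n. \<Sum>a\<in>{1, 2, 3}. g (Suc i) a)" for a
    unfolding Suc[symmetric]
    by (simp add: prod.lessThan_Suc_shift o_def sum_list_const_mult del: prod.lessThan_Suc)
  then show ?case
    unfolding tuples map_append sum_list_append
    by (simp add: prod.lessThan_Suc_shift algebra_simps del: prod.lessThan_Suc)
qed

lemma sum_P3_tuples_nth:
  "(\<Sum>l<length (P3_tuples n). f (P3_tuples n ! l)) = (\<Sum>z\<leftarrow>P3_tuples n. f z)"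
  by (simp add: sum_list_sum_nth atLeast0LessThan)

lemma nth_P3_tuples:
  assumes "p < length (P3_tuples n)"
  shows "length (P3_tuples n ! p) = n"
    and "i < n \<Longrightarrow> P3_tuples n ! p ! i \<in> {1, 2, 3}"
proof -
  have *: "P3_tuples n ! p \<in> {xs. length xs = n \<and> set xs \<subseteq> {1, 2, 3}}"
    using assms nth_mem set_P3_tuples by blast
  then show len: "length (P3_tuples n ! p) = n" by simp
  show "P3_tuples n ! p ! i \<in> {1, 2, 3}" if "i < n"
    using * nth_mem[of i "P3_tuples n ! p", unfolded len, OF that] by blast
qed

lemma prod_of_bool:
  "finite A \<Longrightarrow> (\<Prod>i\<in>A. of_bool (P i)) = (of_bool (\<forall>i\<in>A. P i) :: 'a :: comm_semiring_1)"
  by (induction A rule: finite_induct) auto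

section \<open>Spectral decomposition\<close>

text \<open>The eigenvalues are indexed by the vertices 1, 2, 3, so that \<open>P3_tuples\<close>
  enumerates the tensor eigenvectors too.\<close>

definition P3_eigval :: "nat \<Rightarrow> real" where
  "P3_eigval a = sqrt 2 * (2 - real a)"

text \<open>Row \<open>a\<close> (equivalently column \<open>a\<close>) is a unit eigenvector for the eigenvalue \<open>P3_eigval a\<close>.\<close>

definition P3_eigvec :: "nat \<Rightarrow> nat \<Rightarrow> real" where
  "P3_eigvec x y =
     (if x = 2 \<and> y = 2 then 0
      else if x \<noteq> 2 \<and> y \<noteq> 2 then 1 / 2
      else if x = 3 \<or> y = 3 then - sqrt 2 / 2
      else sqrt 2 / 2)"

text \<open>The eigenvectors are orthonormal and the matrix they form is symmetric, so it is its own
  inverse.\<close>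

lemma P3_eigvec_involution:
  assumes "x \<in> {1, 2, 3}" "y \<in> {1, 2, 3}"
  shows "(\<Sum>a\<in>{1, 2, 3}. P3_eigvec x a * P3_eigvec a y) = of_bool (x = y)"
  using assms by (auto simp: P3_eigvec_def)

lemma P3_adj_decomposition:
  assumes "x \<in> {1, 2, 3}" "y \<in> {1, 2, 3}"
  shows "(\<Sum>a\<in>{1, 2, 3}. P3_eigvec x a * P3_eigval a * P3_eigvec a y) = of_bool (P3_adj x y)"
  using assms by (auto simp: P3_eigvec_def P3_eigval_def P3_adj_def doubleton_eq_iff)

definition tensor_eigvec :: "nat \<Rightarrow> nat list \<Rightarrow> nat list \<Rightarrow> real" where
  "tensor_eigvec n x z = (\<Prod>i<n. P3_eigvec (x ! i) (z ! i))"

text \<open>The exponent is a switch: a factor where \<beta> is 1 contributes an eigenvalue of the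
  path, a factor where \<beta> is 0 contributes the eigenvalue 1 of the identity.\<close>

definition tuple_eigval :: "nat \<Rightarrow> nat list \<Rightarrow> nat list \<Rightarrow> real" where
  "tuple_eigval n \<beta> z = (\<Prod>i<n. P3_eigval (z ! i) ^ (\<beta> ! i))"

definition NEPS_eigval :: "nat \<Rightarrow> nat list set \<Rightarrow> nat list \<Rightarrow> real" where
  "NEPS_eigval n \<Omega> z = (\<Sum>\<beta>\<in>\<Omega>. tuple_eigval n \<beta> z)"

lemma tensor_eigvec_involution:
  assumes "length x = n" "length y = n"
    and "\<And>i. i < n \<Longrightarrow> x ! i \<in> {1, 2, 3}" "\<And>i. i < n \<Longrightarrow> y ! i \<in> {1, 2, 3}"
  shows "(\<Sum>z\<leftarrow>P3_tuples n. tensor_eigvec n x z * tensor_eigvec n z y) = of_bool (x = y)"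
proof -
  have "(\<Sum>z\<leftarrow>P3_tuples n. tensor_eigvec n x z * tensor_eigvec n z y) =
      (\<Sum>z\<leftarrow>P3_tuples n. \<Prod>i<n. P3_eigvec (x ! i) (z ! i) * P3_eigvec (z ! i) (y ! i))"
    by (simp add: tensor_eigvec_def prod.distrib)
  also have "\<dots> = (\<Prod>i<n. of_bool (x ! i = y ! i))"
    unfolding sum_P3_tuples_prod[where n = n and g = "\<lambda>i a. P3_eigvec (x ! i) a * P3_eigvec a (y ! i)"]
    by (intro prod.cong refl P3_eigvec_involution) (use assms in auto)
  also have "\<dots> = of_bool (x = y)"
    using assms(1,2) by (auto simp: prod_of_bool list_eq_iff_nth_eq)
  finally show ?thesis .
qed

text \<open>The right-hand side is an entry of a tensor product whose factors are the identity or
  the adjacency matrix of the path, so it is diagonalised factor by factor.\<close>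

lemma tuple_adj_decomposition:
  assumes \<beta>: "length \<beta> = n" "set \<beta> \<subseteq> {0, 1}"
    and "\<And>i. i < n \<Longrightarrow> x ! i \<in> {1, 2, 3}" "\<And>i. i < n \<Longrightarrow> y ! i \<in> {1, 2, 3}"
  shows "(\<Sum>z\<leftarrow>P3_tuples n. tensor_eigvec n x z * tuple_eigval n \<beta> z * tensor_eigvec n z y) =
    of_bool (\<forall>i<n. (\<beta> ! i = 0 \<longrightarrow> x ! i = y ! i) \<and> (\<beta> ! i = 1 \<longrightarrow> P3_adj (x ! i) (y ! i)))"
proof -
  have bit: "\<beta> ! i \<in> {0, 1}" if "i < n" for i
    using \<beta> that nth_mem by blast
  have "(\<Sum>z\<leftarrow>P3_tuples n. tensor_eigvec n x z * tuple_eigval n \<beta> z * tensor_eigvec n z y) =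
      (\<Sum>z\<leftarrow>P3_tuples n. \<Prod>i<n.
        P3_eigvec (x ! i) (z ! i) * P3_eigval (z ! i) ^ (\<beta> ! i) * P3_eigvec (z ! i) (y ! i))"
    by (simp add: tensor_eigvec_def tuple_eigval_def prod.distrib)
  also have "\<dots> = (\<Prod>i<n. of_bool ((\<beta> ! i = 0 \<longrightarrow> x ! i = y ! i) \<and>
      (\<beta> ! i = 1 \<longrightarrow> P3_adj (x ! i) (y ! i))))"
    unfolding sum_P3_tuples_prod
      [where n = n and g = "\<lambda>i a. P3_eigvec (x ! i) a * P3_eigval a ^ (\<beta> ! i) * P3_eigvec a (y ! i)"]
  proof (intro prod.cong refl)
    fix i assume "i \<in> {..<n}"
    then have i: "i < n" by simp
    show "(\<Sum>a\<in>{1, 2, 3}. P3_eigvec (x ! i) a * P3_eigval a ^ (\<beta> ! i) * P3_eigvec a (y ! i)) =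
        of_bool ((\<beta> ! i = 0 \<longrightarrow> x ! i = y ! i) \<and> (\<beta> ! i = 1 \<longrightarrow> P3_adj (x ! i) (y ! i)))"
      \<comment> \<open>Bit 0 leaves the involution identity, bit 1 the spectral decomposition of
        the path.\<close>
      using bit[OF i] P3_eigvec_involution[OF assms(3,4)[OF i]]
        P3_adj_decomposition[OF assms(3,4)[OF i]]
      by (elim insertE emptyE) simp_all
  qed
  also have "\<dots> = of_bool (\<forall>i<n. (\<beta> ! i = 0 \<longrightarrow> x ! i = y ! i) \<and>
      (\<beta> ! i = 1 \<longrightarrow> P3_adj (x ! i) (y ! i)))"
    by (auto simp: prod_of_bool)
  finally show ?thesis .
qed

text \<open>Since \<open>P\<^sub>3\<close> has no loops, the tuple witnessing an adjacency is unique; hence the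
  adjacency matrix is the sum of the contributions of the individual tuples.\<close>

lemma of_bool_NEPS_P3_adj:
  assumes \<Omega>: "\<Omega> \<subseteq> {\<beta>. length \<beta> = n \<and> set \<beta> \<subseteq> {0, 1}}" and fin: "finite \<Omega>"
  shows "of_bool (NEPS_P3_adj n \<Omega> x y) =
    (\<Sum>\<beta>\<in>\<Omega>. of_bool (\<forall>i<n. (\<beta> ! i = 0 \<longrightarrow> x ! i = y ! i) \<and>
      (\<beta> ! i = 1 \<longrightarrow> P3_adj (x ! i) (y ! i))) :: real)"
    (is "_ = (\<Sum>\<beta>\<in>\<Omega>. of_bool (?adj \<beta>))")
proof (cases "\<exists>\<beta>\<in>\<Omega>. ?adj \<beta>")
  case False
  have "of_bool (?adj \<beta>) = (0 :: real)" if "\<beta> \<in> \<Omega>" for \<beta>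
    using False that unfolding of_bool_eq_0_iff by blast
  then have "(\<Sum>\<beta>\<in>\<Omega>. of_bool (?adj \<beta>) :: real) = 0"
    by (intro sum.neutral) blast
  moreover have "\<not> NEPS_P3_adj n \<Omega> x y"
    using False unfolding NEPS_P3_adj_def .
  ultimately show ?thesis by simp
next
  case True
  have loopless: "x ! i \<noteq> y ! i" if "P3_adj (x ! i) (y ! i)" for i
    using that by (auto simp: P3_adj_def doubleton_eq_iff)
  have witness: "\<beta> ! i = of_bool (x ! i \<noteq> y ! i)" if "\<beta> \<in> \<Omega>" "?adj \<beta>" "i < n" for \<beta> i
  proof -
    have "\<beta> ! i \<in> {0, 1}" using that(1,3) \<Omega> nth_mem by blast
    then show ?thesis using that(2,3) loopless by auto
  qed
  obtain \<gamma> where \<gamma>: "\<gamma> \<in> \<Omega>" "?adj \<gamma>" using True by blast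
  have "?adj \<beta> \<longleftrightarrow> \<beta> = \<gamma>" if "\<beta> \<in> \<Omega>" for \<beta>
  proof
    assume "?adj \<beta>"
    show "\<beta> = \<gamma>"
    proof (rule nth_equalityI)
      show "length \<beta> = length \<gamma>" using \<open>\<beta> \<in> \<Omega>\<close> \<gamma>(1) \<Omega> by auto
      show "\<beta> ! i = \<gamma> ! i" if "i < length \<beta>" for i
        using that witness[OF \<open>\<beta> \<in> \<Omega>\<close> \<open>?adj \<beta>\<close>] witness[OF \<gamma>] \<open>\<beta> \<in> \<Omega>\<close> \<Omega> by auto
    qed
  qed (use \<gamma> in simp)
  then have "(\<Sum>\<beta>\<in>\<Omega>. of_bool (?adj \<beta>) :: real) = (\<Sum>\<beta>\<in>\<Omega>. if \<beta> = \<gamma> then 1 else 0)"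
    by (intro sum.cong) auto
  then show ?thesis
    using True fin \<gamma> by (auto simp: NEPS_P3_adj_def)
qed

definition tensor_eigvec_mat :: "nat \<Rightarrow> complex mat" where
  "tensor_eigvec_mat n = mat (length (P3_tuples n)) (length (P3_tuples n))
     (\<lambda>(p, q). of_real (tensor_eigvec n (P3_tuples n ! p) (P3_tuples n ! q)))"

text \<open>The diagonalising matrix does not depend on \<Omega>. Hence transition matrices for
  different \<Omega> can be compared eigenvalue by eigenvalue.\<close>

lemma NEPS_adjacency_diagonalizable:
  assumes \<Omega>: "\<Omega> \<subseteq> {\<beta>. length \<beta> = n \<and> set \<beta> \<subseteq> {0, 1}}" and fin: "finite \<Omega>"
  shows "similar_mat_wit (adjacency_mat (P3_tuples n) (NEPS_P3_adj n \<Omega>))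
    (mat_diag (length (P3_tuples n)) (\<lambda>l. of_real (NEPS_eigval n \<Omega> (P3_tuples n ! l))))
    (tensor_eigvec_mat n) (tensor_eigvec_mat n)"
proof (rule similar_mat_witI)
  let ?vs = "P3_tuples n" and ?W = "tensor_eigvec_mat n"
  let ?N = "length ?vs" and ?A = "adjacency_mat (P3_tuples n) (NEPS_P3_adj n \<Omega>)"
  let ?d = "\<lambda>l. complex_of_real (NEPS_eigval n \<Omega> (?vs ! l))"
  show W: "?W \<in> carrier_mat ?N ?N" "?W \<in> carrier_mat ?N ?N"
    by (simp_all add: tensor_eigvec_mat_def)
  show A: "?A \<in> carrier_mat ?N ?N" by (simp add: adjacency_mat_def)
  \<comment> \<open>Distinctness turns equality of tuples into equality of matrix indices, as the
    identity matrix requires.\<close>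
  have dist: "distinct ?vs"
    using sorted_P3_tuples[of n] by (simp add: strict_sorted_iff)
  show WW: "?W * ?W = 1\<^sub>m ?N"
  proof (rule eq_matI)
    fix p q assume "p < dim_row (1\<^sub>m ?N)" "q < dim_col (1\<^sub>m ?N)"
    then have p: "p < ?N" and q: "q < ?N" by simp_all
    have "(?W * ?W) $$ (p, q) = of_real (\<Sum>l<?N.
        tensor_eigvec n (?vs ! p) (?vs ! l) * tensor_eigvec n (?vs ! l) (?vs ! q))"
      using p q by (simp add: tensor_eigvec_mat_def scalar_prod_def atLeast0LessThan)
    also have "\<dots> = of_real (of_bool (?vs ! p = ?vs ! q))"
      unfolding sum_P3_tuples_nth
        [of "\<lambda>z. tensor_eigvec n (?vs ! p) z * tensor_eigvec n z (?vs ! q)" n]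
      by (subst tensor_eigvec_involution) (use p q nth_P3_tuples in blast)+
    also have "\<dots> = 1\<^sub>m ?N $$ (p, q)"
      using p q dist by (simp add: nth_eq_iff_index_eq)
    finally show "(?W * ?W) $$ (p, q) = 1\<^sub>m ?N $$ (p, q)" .
  qed (use W in auto)
  then show "?W * ?W = 1\<^sub>m ?N" .
  show "?A = ?W * mat_diag ?N ?d * ?W"
  proof (rule eq_matI)
    fix p q assume "p < dim_row (?W * mat_diag ?N ?d * ?W)" "q < dim_col (?W * mat_diag ?N ?d * ?W)"
    then have p: "p < ?N" and q: "q < ?N" using W by auto
    let ?term = "\<lambda>f z. tensor_eigvec n (?vs ! p) z * f z * tensor_eigvec n z (?vs ! q)"
    have "(?W * mat_diag ?N ?d * ?W) $$ (p, q) =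
        of_real (\<Sum>l<?N. ?term (NEPS_eigval n \<Omega>) (?vs ! l))"
      using p q unfolding index_mult_mat_diag_mult[OF W p q] by (simp add: tensor_eigvec_mat_def)
    \<comment> \<open>Exchanging the sums isolates the contribution of each single tuple
      \<beta>.\<close>
    also have "(\<Sum>l<?N. ?term (NEPS_eigval n \<Omega>) (?vs ! l)) =
        (\<Sum>\<beta>\<in>\<Omega>. \<Sum>l<?N. ?term (tuple_eigval n \<beta>) (?vs ! l))"
      unfolding NEPS_eigval_def sum_distrib_left sum_distrib_right by (rule sum.swap)
    also have "\<dots> = of_bool (NEPS_P3_adj n \<Omega> (?vs ! p) (?vs ! q))"
      unfolding of_bool_NEPS_P3_adj[OF \<Omega> fin]
    proof (intro sum.cong refl)
      fix \<beta> assume "\<beta> \<in> \<Omega>"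
      then have \<beta>: "length \<beta> = n" "set \<beta> \<subseteq> {0, 1}" using \<Omega> by auto
      show "(\<Sum>l<?N. ?term (tuple_eigval n \<beta>) (?vs ! l)) =
          of_bool (\<forall>i<n. (\<beta> ! i = 0 \<longrightarrow> ?vs ! p ! i = ?vs ! q ! i) \<and>
            (\<beta> ! i = 1 \<longrightarrow> P3_adj (?vs ! p ! i) (?vs ! q ! i)))"
        unfolding sum_P3_tuples_nth[of "?term (tuple_eigval n \<beta>)" n]
        by (rule tuple_adj_decomposition[OF \<beta>]) (use p q nth_P3_tuples in blast)+
    qed
    also have "complex_of_real \<dots> = ?A $$ (p, q)"
      using p q by (simp add: adjacency_mat_def)
    finally show "?A $$ (p, q) = (?W * mat_diag ?N ?d * ?W) $$ (p, q)" ..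
  qed (use W A in auto)
qed simp

lemma H_NEPS_P3_spectral:
  assumes "\<Omega> \<subseteq> {\<beta>. length \<beta> = n \<and> set \<beta> \<subseteq> {0, 1}}" "finite \<Omega>"
  shows "H_NEPS_P3 n \<Omega> t = tensor_eigvec_mat n *
    mat_diag (length (P3_tuples n)) (\<lambda>l. cis (- (t * NEPS_eigval n \<Omega> (P3_tuples n ! l)))) *
    tensor_eigvec_mat n"
proof -
  have smult: "c \<cdot>\<^sub>m mat_diag N d = mat_diag N (\<lambda>l. c * d l)" for c :: complex and N d
    by (auto simp: mat_diag_def)
  show ?thesis
    unfolding H_NEPS_P3_def transition_mat_def
      mat_exp_diagonalizable[OF similar_mat_wit_smult[OF NEPS_adjacency_diagonalizable[OF assms],
        of "- \<i> * complex_of_real t", unfolded smult]]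
    by (simp add: cis_conv_exp mult.assoc)
qed

section \<open>Arithmetic of the eigenvalues\<close>

lemma num_nonzero_conv_sum:
  "set \<beta> \<subseteq> {0, 1} \<Longrightarrow> num_nonzero \<beta> = (\<Sum>i<length \<beta>. \<beta> ! i)"
proof -
  assume "set \<beta> \<subseteq> {0, 1}"
  then have "num_nonzero \<beta> = sum_list \<beta>"
    by (induction \<beta>) (auto simp: num_nonzero_def)
  then show ?thesis by (simp add: sum_list_sum_nth atLeast0LessThan)
qed

text \<open>Every coordinate with bit 1 supplies one factor sqrt 2; what remains is an
  integer.\<close>

lemma tuple_eigval_eq:
  assumes "length \<beta> = n" "set \<beta> \<subseteq> {0, 1}"
  shows "tuple_eigval n \<beta> z =
    sqrt 2 ^ num_nonzero \<beta> * of_int (\<Prod>i<n. (2 - int (z ! i)) ^ (\<beta> ! i))"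
  using num_nonzero_conv_sum[OF assms(2)] assms(1)
  by (simp add: tuple_eigval_def P3_eigval_def power_mult_distrib prod.distrib power_sum)

text \<open>The excess of \<open>num_nonzero \<beta>\<close> over \<open>k\<close> is even and
  positive, so the surplus power of sqrt 2 is an integer power of 2 with positive exponent.\<close>

lemma scaled_tuple_eigval_multiple:
  assumes "length \<beta> = n" "set \<beta> \<subseteq> {0, 1}"
    and "k < num_nonzero \<beta>" "even (num_nonzero \<beta>) = even k"
  shows "pi / sqrt 2 ^ k * tuple_eigval n \<beta> z / (2 * pi) \<in> \<int>"
proof -
  have "even (num_nonzero \<beta> - k)" "num_nonzero \<beta> - k > 0"
    using assms(3,4) by auto
  \<comment> \<open>The form \<open>Suc m\<close> sets aside one factor 2, which cancels the 2 in
    the denominator \<open>2 * pi\<close>.\<close>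
  then obtain m where "num_nonzero \<beta> - k = 2 * Suc m"
    by (metis dvdE gr0_implies_Suc mult_0_right not_gr_zero)
  then have "num_nonzero \<beta> = k + 2 * Suc m" using assms(3) by linarith
  then have "sqrt 2 ^ num_nonzero \<beta> = sqrt 2 ^ k * 2 ^ Suc m"
    by (simp add: power_add power_mult)
  then have "pi / sqrt 2 ^ k * tuple_eigval n \<beta> z / (2 * pi) =
      of_int (2 ^ m * (\<Prod>i<n. (2 - int (z ! i)) ^ (\<beta> ! i)))"
    by (simp add: tuple_eigval_eq[OF assms(1,2)])
  then show ?thesis by (metis Ints_of_int)
qed

theorem theorem4p6:
  fixes n k :: nat and \<Omega> \<Omega>' :: "nat list set" and \<tau> :: "nat \<Rightarrow> real"
  assumes "\<Omega> \<subseteq> {\<beta>. length \<beta> = n \<and> set \<beta> \<subseteq> {0, 1} \<and> \<beta> \<noteq> replicate n 0}"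
    and "(\<forall>\<beta>\<in>\<Omega>. even (num_nonzero \<beta>)) \<or> (\<forall>\<beta>\<in>\<Omega>. odd (num_nonzero \<beta>))"
  defines "k \<equiv> Min (num_nonzero ` \<Omega>)"
    and "\<Omega>' \<equiv> {\<beta> \<in> \<Omega>. num_nonzero \<beta> = k}"
    and "\<tau> \<equiv> \<lambda>m. pi / sqrt 2 ^ m"
  shows "H_NEPS_P3 n \<Omega> (\<tau> k) = H_NEPS_P3 n \<Omega>' (\<tau> k)"
proof -
  have \<Omega>: "\<Omega> \<subseteq> {\<beta>. length \<beta> = n \<and> set \<beta> \<subseteq> {0, 1}}" using assms(1) by auto
  have "finite {\<beta> :: nat list. set \<beta> \<subseteq> {0, 1} \<and> length \<beta> = n}"
    by (rule finite_lists_length_eq) simp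
  then have fin: "finite \<Omega>"
    by (rule rev_finite_subset) (use \<Omega> in auto)
  have sub: "\<Omega>' \<subseteq> \<Omega>" by (auto simp: \<Omega>'_def)
  have "\<tau> k * tuple_eigval n \<beta> z / (2 * pi) \<in> \<int>" if "\<beta> \<in> \<Omega> - \<Omega>'" for \<beta> z
  proof -
    \<comment> \<open>The given \<beta> makes \<Omega> nonempty, so the minimum is attained and
      \<open>k\<close> has the common parity. For empty \<Omega> the value of \<open>Min\<close> is
      unspecified, but there is no \<beta> to treat.\<close>
    have "k \<in> num_nonzero ` \<Omega>"
      unfolding k_def by (rule Min_in) (use fin that in auto)
    then have "even (num_nonzero \<beta>) = even k" using assms(2) that by auto
    moreover have "k < num_nonzero \<beta>"
      using that fin by (auto simp: \<Omega>'_def k_def less_le)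
    ultimately show ?thesis
      unfolding \<tau>_def using that \<Omega> by (intro scaled_tuple_eigval_multiple) auto
  qed
  then have rest: "(\<Sum>\<beta>\<in>\<Omega> - \<Omega>'. \<tau> k * tuple_eigval n \<beta> z / (2 * pi)) \<in> \<int>" for z
    by (intro Ints_sum) auto
  have "cis (- (\<tau> k * NEPS_eigval n \<Omega> z)) = cis (- (\<tau> k * NEPS_eigval n \<Omega>' z))" for z
  proof -
    obtain m where m: "(\<Sum>\<beta>\<in>\<Omega> - \<Omega>'. \<tau> k * tuple_eigval n \<beta> z / (2 * pi)) = of_int m"
      using rest[of z] unfolding Ints_def by blast
    \<comment> \<open>The tuples outside \<Omega>' change the phase only by a multiple of
      \<open>2 * pi\<close>.\<close>
    have "NEPS_eigval n \<Omega> z = NEPS_eigval n \<Omega>' z + (\<Sum>\<beta>\<in>\<Omega> - \<Omega>'. tuple_eigval n \<beta> z)"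
      unfolding NEPS_eigval_def using sum.subset_diff[OF sub fin] by (simp add: add.commute)
    moreover have "\<tau> k * (\<Sum>\<beta>\<in>\<Omega> - \<Omega>'. tuple_eigval n \<beta> z) = 2 * pi * of_int m"
      unfolding m[symmetric] by (simp add: sum_distrib_left)
    ultimately have "- (\<tau> k * NEPS_eigval n \<Omega> z) =
        - (\<tau> k * NEPS_eigval n \<Omega>' z) + 2 * pi * of_int (- m)"
      by (simp add: algebra_simps)
    moreover have "cis (2 * pi * of_int (- m)) = 1"
      by (rule cis_multiple_2pi) simp
    ultimately show ?thesis by (metis cis_mult mult_1_right)
  qed
  \<comment> \<open>Both sides conjugate a diagonal matrix of phases by the same
    \<open>tensor_eigvec_mat n\<close>, so equality of the phases suffices.\<close>
  then show ?thesis
    unfolding H_NEPS_P3_spectral[OF \<Omega> fin]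
      H_NEPS_P3_spectral[OF subset_trans[OF sub \<Omega>] finite_subset[OF sub fin]] by simp
qed

end
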